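(* Let $f$ be a probability density on $[0,\infty)$ with $0<W=\int_0^\infty t f(t)\,dt<\infty$, $f\in C^{(2)}([0,\infty))$ and $\sup_{t\ge 0}|f''(t)|<\infty$. Let $Y_1,Y_2,\dots$ be i.i.d. with density $g(y)=\frac{1}{W}\,y f(y)$, $y\ge 0$, and fix $x>0$ with $f(x)>0$. For positive integers $n,\alpha$ let $$\widehat f^*_\alpha(x)=\frac1n\sum_{i=1}^n \frac{W}{Y_i^2}\cdot\frac{1}{\Gamma(\alpha)}\Big(\frac{\alpha Y_i}{x}\Big)^{\alpha}\exp\Big(-\frac{\alpha}{x}Y_i\Big).$$ If $\alpha=\alpha(n)\sim n^\delta$ for some $\frac25<\delta<2$, then, as $n\to\infty$, $$\frac{n^{1/2}}{\alpha^{1/4}}\{\widehat f^*_\alpha(x)-f(x)\}\to_d \mathrm{Normal}\left(0,\frac{W f(x)}{2x^2\sqrt\pi}\right).$$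
   Context: This is the length-biased sampling model: $f$ is the target density and one observes $Y_1,\dots,Y_n$ from $g$; $W$ is treated as known in the estimator. $\mathrm{Normal}(\mu,\sigma^2)$ is the normal law with mean $\mu$ and variance $\sigma^2$; $\to_d$ denotes convergence in distribution; $a_n\sim b_n$ means $a_n/b_n\to1$. *)

theory Defs
  imports "HOL-Probability.Probability" "HOL-Library.Landau_Symbols"
begin

text \<open>
  Functions on the half-line \<open>[0, \<infinity>)\<close> are total functions whose values on
  negative arguments are never used.
\<close>

definition prob_density_on_halfline :: "(real \<Rightarrow> real) \<Rightarrow> bool" where
  "prob_density_on_halfline f \<longleftrightarrow>
     (\<forall>t\<ge>0. 0 \<le> f t) \<and> set_integrable lborel {0..} f \<and> (LINT t:{0..}|lborel. f t) = 1"

text \<open>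
  \<open>f\<close> is \<open>C\<^sup>2\<close> on \<open>[0, \<infinity>)\<close> with first and second derivatives \<open>f1\<close> and \<open>f2\<close>; at the
  endpoint \<open>0\<close> the derivatives are one-sided. The values of \<open>f1\<close> and \<open>f2\<close> on
  \<open>[0, \<infinity>)\<close> are determined by \<open>f\<close>.
\<close>

definition C2_on_halfline_with_derivs ::
    "(real \<Rightarrow> real) \<Rightarrow> (real \<Rightarrow> real) \<Rightarrow> (real \<Rightarrow> real) \<Rightarrow> bool" where
  "C2_on_halfline_with_derivs f f1 f2 \<longleftrightarrow>
     (\<forall>t\<ge>0. (f has_real_derivative f1 t) (at t within {0..})) \<and>
     (\<forall>t\<ge>0. (f1 has_real_derivative f2 t) (at t within {0..})) \<and>
     continuous_on {0..} f2"

definition length_biased_density :: "(real \<Rightarrow> real) \<Rightarrow> real \<Rightarrow> real \<Rightarrow> real" where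
  "length_biased_density f W y = indicator {0..} y * (1 / W * (y * f y))"

text \<open>
  The estimator at \<open>x\<close> from the observations \<open>y 1, \<dots>, y n\<close>. A zero observation
  contributes \<open>0\<close> (division by zero), which is an event of probability \<open>0\<close>.
\<close>

definition gamma_estimator :: "real \<Rightarrow> nat \<Rightarrow> nat \<Rightarrow> (nat \<Rightarrow> real) \<Rightarrow> real \<Rightarrow> real" where
  "gamma_estimator W n a y x =
     1 / real n * (\<Sum>i=1..n. W / (y i)\<^sup>2 *
        (1 / Gamma (real a) * (real a * y i / x) ^ a * exp (- (real a / x) * y i)))"

text \<open>The normal law with mean \<open>\<mu>\<close> and variance \<open>v > 0\<close>
  (\<open>normal_density\<close> takes the standard deviation).\<close>

definition normal_law :: "real \<Rightarrow> real \<Rightarrow> real measure" where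
  "normal_law \<mu> v = density lborel (\<lambda>t. ennreal (normal_density \<mu> (sqrt v) t))"

end

theory Submission
  imports Defs
begin

text \<open>
  The estimator is an average of i.i.d. copies of \<open>T(Y)\<close>, where \<open>T\<close> is the kernel
  \<open>gamma_kernel W a x\<close> with \<open>a = \<alpha> n\<close>. The length bias \<open>y / W\<close> cancels against the weight in \<open>T\<close>, so
  that both moments of \<open>T(Y)\<close> are integrals of \<open>f\<close> against Gamma densities concentrating at \<open>x\<close>:

  \<^item> the mean is the integral against the Gamma density with mean \<open>x\<close> and variance \<open>x\<^sup>2 / a\<close>. As \<open>f''\<close>
    is bounded, \<open>f\<close> differs from its tangent at \<open>x\<close> by at most a multiple of \<open>(y - x)\<^sup>2\<close>, and the
    bias is \<open>O(1 / a)\<close> (\<open>erlang_smoothing_same_mean\<close>). After multiplication by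
    \<open>n powr (1/2) / a powr (1/4)\<close> it vanishes because \<open>\<delta> > 2/5\<close>;

  \<^item> the second moment is an explicit constant times a smoothed value of \<open>f\<close> that tends to \<open>f x\<close>
    (\<open>length_biased_times_kernel_sq\<close>, \<open>erlang_smoothing_double_shape\<close>). The constant contains a
    central binomial coefficient and is asymptotic to \<open>W * sqrt a / (2 * x\<^sup>2 * sqrt pi)\<close>
    (\<open>kernel_sq_factor_asymptotic\<close>), which explains both the norming \<open>a powr (1/4)\<close> and the
    variance of the limit.

  The shape \<open>a\<close> changes with \<open>n\<close>, so a limit theorem for triangular arrays is required. A Stirling
  bound shows that \<open>T\<close> is at most a multiple of \<open>sqrt a\<close> on the half-line (\<open>gamma_kernel_bounds\<close>); hence the
  normalized summands are uniformly of order \<open>a powr (1/4) / n powr (1/2)\<close>, which tends to \<open>0\<close>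
  because \<open>\<delta> < 2\<close>. For uniformly small summands the central limit theorem follows directly from the
  expansion of characteristic functions and Levy's continuity theorem
  (\<open>bounded_triangular_array_clt\<close>).
\<close>

section \<open>Central limit theorem for arrays of uniformly small summands\<close>

lemma exp_minus_linear_bound:
  fixes s :: real
  assumes "0 \<le> s"
  shows "\<bar>exp (- s) - (1 - s)\<bar> \<le> s\<^sup>2"
proof -
  have "exp (- s) = 1 / exp s"
    by (simp add: exp_minus field_simps)
  also have "\<dots> \<le> 1 / (1 + s)"
    using exp_ge_add_one_self[of s] assms by (intro divide_left_mono) auto
  also have "\<dots> \<le> 1 - s + s\<^sup>2"
  proof -
    have "(1 - s + s\<^sup>2) * (1 + s) = 1 + s ^ 3"
      by (simp add: algebra_simps power2_eq_square power3_eq_cube)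
    then show ?thesis
      using assms by (simp add: divide_le_eq)
  qed
  finally show ?thesis
    using exp_ge_add_one_self[of "- s"] by simp
qed

text \<open>
  A summand that is centred and bounded by \<open>\<epsilon>\<close> has third absolute moment at most \<open>\<epsilon> * v\<close> and
  variance \<open>v \<le> \<epsilon>\<^sup>2\<close>. The second-order expansion of its characteristic function, with a third-moment
  remainder, therefore costs \<open>\<epsilon> * v\<close>, and replacing \<open>1 - t\<^sup>2 * v / 2\<close> by the exponential costs
  \<open>v\<^sup>2 \<le> \<epsilon>\<^sup>2 * v\<close>. The error is linear in \<open>v\<close>, so that errors add up over a row of an array
  to a multiple of the total variance. Comparing with the exponential rather than with the
  quadratic polynomial makes the product over a row depend on the total variance only.
\<close>

lemma (in prob_space) char_bounded_centered_approx:
  fixes X :: "'a \<Rightarrow> real"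
  assumes rv[measurable]: "random_variable borel X"
    and mean: "expectation X = 0"
    and bound: "AE \<omega> in M. \<bar>X \<omega>\<bar> \<le> \<epsilon>"
  defines "v \<equiv> expectation (\<lambda>\<omega>. (X \<omega>)\<^sup>2)"
  shows "cmod (char (distr M borel X) t - of_real (exp (- (t\<^sup>2 * v / 2))))
           \<le> (\<bar>t\<bar> ^ 3 / 6 * \<epsilon> + t ^ 4 / 4 * \<epsilon>\<^sup>2) * v"
proof -
  have int1: "integrable M X"
    using bound by (intro integrable_const_bound[where B=\<epsilon>]) auto
  have sq: "AE \<omega> in M. (X \<omega>)\<^sup>2 \<le> \<epsilon>\<^sup>2"
    using bound by eventually_elim (metis abs_ge_zero power2_abs power_mono)
  have int2: "integrable M (\<lambda>\<omega>. (X \<omega>)\<^sup>2)"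
    using sq by (intro integrable_const_bound[where B="\<epsilon>\<^sup>2"]) auto
  have v0: "0 \<le> v"
    unfolding v_def by simp
  have v_le: "v \<le> \<epsilon>\<^sup>2"
  proof -
    have "v \<le> expectation (\<lambda>\<omega>. \<epsilon>\<^sup>2)"
      unfolding v_def using sq int2 by (intro integral_mono_AE) auto
    then show ?thesis by (simp add: prob_space)
  qed
  let ?m = "\<lambda>\<omega>. min (6 * (X \<omega>)\<^sup>2) (\<bar>t\<bar> * \<bar>X \<omega>\<bar> ^ 3)"
  have m_int: "integrable M ?m"
    by (rule Bochner_Integration.integrable_bound[of _ "\<lambda>\<omega>. 6 * (X \<omega>)\<^sup>2"]) (use int2 in auto)
  have m_le: "AE \<omega> in M. ?m \<omega> \<le> \<bar>t\<bar> * \<epsilon> * (X \<omega>)\<^sup>2"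
    using bound
  proof eventually_elim
    case (elim \<omega>)
    have "\<bar>X \<omega>\<bar> ^ 3 = \<bar>X \<omega>\<bar> * (X \<omega>)\<^sup>2"
      by (simp add: power3_eq_cube power2_eq_square)
    also have "\<dots> \<le> \<epsilon> * (X \<omega>)\<^sup>2"
      using elim by (intro mult_right_mono) auto
    finally have "\<bar>t\<bar> * \<bar>X \<omega>\<bar> ^ 3 \<le> \<bar>t\<bar> * (\<epsilon> * (X \<omega>)\<^sup>2)"
      by (intro mult_left_mono) auto
    then show ?case by (simp add: mult.assoc)
  qed
  have "expectation ?m \<le> expectation (\<lambda>\<omega>. \<bar>t\<bar> * \<epsilon> * (X \<omega>)\<^sup>2)"
    using m_le int2 m_int by (intro integral_mono_AE) auto
  also have "\<dots> = \<bar>t\<bar> * \<epsilon> * v"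
    unfolding v_def by simp
  finally have E3: "expectation ?m \<le> \<bar>t\<bar> * \<epsilon> * v" .
  have "cmod (char (distr M borel X) t - (1 - t\<^sup>2 * v / 2)) \<le> t\<^sup>2 / 6 * expectation ?m"
    using char_approx3'[OF rv int1 int2 mean _ refl, of v t] by (simp add: v_def mean)
  also have "\<dots> \<le> t\<^sup>2 / 6 * (\<bar>t\<bar> * \<epsilon> * v)"
    using E3 by (intro mult_left_mono) auto
  also have "\<dots> = \<bar>t\<bar> ^ 3 / 6 * \<epsilon> * v"
  proof -
    have "t\<^sup>2 * \<bar>t\<bar> = \<bar>t\<bar> ^ 3"
      by (simp add: power3_eq_cube power2_eq_square)
    then show ?thesis by (simp add: mult.assoc[symmetric])
  qed
  finally have 1: "cmod (char (distr M borel X) t - (1 - t\<^sup>2 * v / 2)) \<le> \<bar>t\<bar> ^ 3 / 6 * \<epsilon> * v" .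
  define s where "s = t\<^sup>2 * v / 2"
  have "cmod (complex_of_real (1 - t\<^sup>2 * v / 2) - of_real (exp (- s))) = \<bar>exp (- s) - (1 - s)\<bar>"
    unfolding s_def
    by (subst norm_minus_commute) (simp only: norm_of_real flip: of_real_diff)
  also have "\<dots> \<le> s\<^sup>2"
    using v0 by (intro exp_minus_linear_bound) (simp add: s_def)
  also have "\<dots> = t ^ 4 / 4 * v * v"
    by (simp add: s_def power2_eq_square power4_eq_xxxx)
  also have "\<dots> \<le> t ^ 4 / 4 * v * \<epsilon>\<^sup>2"
    using v_le v0 by (intro mult_left_mono) auto
  finally have 2: "cmod (complex_of_real (1 - t\<^sup>2 * v / 2) - of_real (exp (- s))) \<le> t ^ 4 / 4 * v * \<epsilon>\<^sup>2" .
  have "cmod (char (distr M borel X) t - of_real (exp (- s)))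
     \<le> \<bar>t\<bar> ^ 3 / 6 * \<epsilon> * v + t ^ 4 / 4 * v * \<epsilon>\<^sup>2"
    using norm_triangle_le[OF add_mono[OF 1 2]] by simp
  then show ?thesis
    by (simp add: s_def algebra_simps)
qed

text \<open>
  A centred normal law is the image of the standard one under scaling, so its characteristic
  function and its being a probability law are inherited from the standard case.
\<close>

lemma normal_law_eq_distr:
  assumes "0 < v"
  shows "normal_law 0 v = distr std_normal_distribution borel (\<lambda>z. sqrt v * z)"
proof -
  interpret N: prob_space std_normal_distribution
    by (rule prob_space_normal_density) simp
  have "distributed std_normal_distribution lborel (\<lambda>z. z) (normal_density 0 1)"
    by (auto simp: distributed_def distr_id2)
  from N.normal_density_affine[OF this, of "sqrt v" 0]
  have "distributed std_normal_distribution lborel (\<lambda>z. sqrt v * z) (normal_density 0 (sqrt v))"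
    using assms by simp
  from distributed_distr_eq_density[OF this] show ?thesis
    unfolding normal_law_def by (simp cong: distr_cong)
qed

lemma char_normal_law:
  assumes "0 < v"
  shows "char (normal_law 0 v) t = of_real (exp (- (t\<^sup>2 * v / 2)))"
proof -
  have "char (normal_law 0 v) t = char std_normal_distribution (t * sqrt v)"
    unfolding normal_law_eq_distr[OF assms] char_def
    by (subst integral_distr) (auto simp: mult.assoc)
  then show ?thesis
    using assms by (simp add: char_std_normal_distribution power_mult_distrib)
qed

lemma real_distribution_normal_law:
  assumes "0 < v"
  shows "real_distribution (normal_law 0 v)"
proof -
  interpret N: real_distribution std_normal_distribution
    by (rule real_dist_normal_dist)
  show ?thesis
    unfolding normal_law_eq_distr[OF assms] by (rule N.real_distribution_distr) simp
qed

lemma (in prob_space) char_distr_add_const: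
  fixes X :: "'a \<Rightarrow> real"
  assumes [measurable]: "random_variable borel X"
  shows "char (distr M borel (\<lambda>\<omega>. X \<omega> + b)) t = char (distr M borel X) t * iexp (t * b)"
  unfolding char_def
  by (simp add: integral_distr distrib_left exp_add flip: Bochner_Integration.integral_mult_left_zero)

text \<open>
  A central limit theorem for rowwise independent arrays whose entries are uniformly small, in
  the setting where Lindeberg's condition is trivial: eventually no entry exceeds any given level.
  The characteristic function of a row is a product of factors within the distance of
  \<open>char_bounded_centered_approx\<close> from exponentials, and a product of numbers in the unit disc moves
  by at most the sum of the changes of its factors. The deterministic shift \<open>b n\<close>, which only
  contributes a factor tending to 1, is there to carry the bias of an estimator.
\<close>

theorem (in prob_space) bounded_triangular_array_clt:
  fixes X :: "nat \<Rightarrow> nat \<Rightarrow> 'a \<Rightarrow> real" and b \<epsilon> :: "nat \<Rightarrow> real" and \<sigma>2 :: real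
  assumes indep: "\<And>n. indep_vars (\<lambda>_. borel) (X n) {1..n}"
    and mean: "\<forall>\<^sub>F n in sequentially. \<forall>i\<in>{1..n}. expectation (X n i) = 0"
    and bound: "\<forall>\<^sub>F n in sequentially. \<forall>i\<in>{1..n}. AE \<omega> in M. \<bar>X n i \<omega>\<bar> \<le> \<epsilon> n"
    and eps: "\<epsilon> \<longlonglongrightarrow> 0"
    and var: "(\<lambda>n. \<Sum>i=1..n. expectation (\<lambda>\<omega>. (X n i \<omega>)\<^sup>2)) \<longlonglongrightarrow> \<sigma>2"
    and shift: "b \<longlonglongrightarrow> 0"
    and pos: "0 < \<sigma>2"
  shows "weak_conv_m (\<lambda>n. distr M borel (\<lambda>\<omega>. (\<Sum>i=1..n. X n i \<omega>) + b n)) (normal_law 0 \<sigma>2)"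
proof (rule levy_continuity)
  have rv: "random_variable borel (X n i)" if "i \<in> {1..n}" for n i
    using indep[of n] that unfolding indep_vars_def2 by auto
  have rv_sum: "random_variable borel (\<lambda>\<omega>. \<Sum>i=1..n. X n i \<omega>)" for n
    using rv by auto
  show "real_distribution (distr M borel (\<lambda>\<omega>. (\<Sum>i=1..n. X n i \<omega>) + b n))" for n
    using rv_sum by (intro real_distribution_distr) auto
  show "real_distribution (normal_law 0 \<sigma>2)"
    by (rule real_distribution_normal_law[OF pos])
  fix t
  define v where "v n i = expectation (\<lambda>\<omega>. (X n i \<omega>)\<^sup>2)" for n i
  define \<phi> where "\<phi> n = char (distr M borel (\<lambda>\<omega>. \<Sum>i=1..n. X n i \<omega>)) t" for n
  let ?g = "\<lambda>n. complex_of_real (exp (- (t\<^sup>2 * (\<Sum>i=1..n. v n i) / 2)))"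
  have v0: "0 \<le> v n i" for n i
    unfolding v_def by simp
  have close: "\<forall>\<^sub>F n in sequentially. cmod (\<phi> n - ?g n) \<le>
      (\<bar>t\<bar> ^ 3 / 6 * \<epsilon> n + t ^ 4 / 4 * (\<epsilon> n)\<^sup>2) * (\<Sum>i=1..n. v n i)"
    using mean bound
  proof eventually_elim
    case (elim n)
    let ?e = "\<lambda>i. complex_of_real (exp (- (t\<^sup>2 * v n i / 2)))"
    have "\<phi> n = (\<Prod>i=1..n. char (distr M borel (X n i)) t)"
      unfolding \<phi>_def by (rule char_distr_sum[OF indep])
    moreover have "?g n = (\<Prod>i=1..n. ?e i)"
      by (simp add: exp_sum[symmetric] sum_negf sum_divide_distrib sum_distrib_left
          flip: of_real_prod)
    ultimately have "cmod (\<phi> n - ?g n) \<le> (\<Sum>i=1..n. cmod (char (distr M borel (X n i)) t - ?e i))"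
      using rv v0
      by (auto intro!: norm_prod_diff real_distribution.cmod_char_le_1 real_distribution_distr
          simp del: of_real_exp)
    also have "\<dots> \<le> (\<Sum>i=1..n. (\<bar>t\<bar> ^ 3 / 6 * \<epsilon> n + t ^ 4 / 4 * (\<epsilon> n)\<^sup>2) * v n i)"
      unfolding v_def using elim rv by (intro sum_mono char_bounded_centered_approx) auto
    finally show ?case
      by (simp add: sum_distrib_left)
  qed
  have var': "(\<lambda>n. \<Sum>i=1..n. v n i) \<longlonglongrightarrow> \<sigma>2"
    using var by (simp add: v_def)
  have "(\<lambda>n. (\<bar>t\<bar> ^ 3 / 6 * \<epsilon> n + t ^ 4 / 4 * (\<epsilon> n)\<^sup>2) * (\<Sum>i=1..n. v n i))
      \<longlonglongrightarrow> (\<bar>t\<bar> ^ 3 / 6 * 0 + t ^ 4 / 4 * 0\<^sup>2) * \<sigma>2"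
    by (intro tendsto_intros eps var')
  then have "(\<lambda>n. \<phi> n - ?g n) \<longlonglongrightarrow> 0"
    by (intro Lim_null_comparison[OF close]) simp
  moreover have "?g \<longlonglongrightarrow> of_real (exp (- (t\<^sup>2 * \<sigma>2 / 2)))"
    by (intro tendsto_intros var') auto
  ultimately have "\<phi> \<longlonglongrightarrow> of_real (exp (- (t\<^sup>2 * \<sigma>2 / 2)))"
    by (rule Lim_transform[rotated])
  moreover have "(\<lambda>n. iexp (t * b n)) \<longlonglongrightarrow> iexp (t * 0)"
    by (intro tendsto_intros shift)
  ultimately have "(\<lambda>n. \<phi> n * iexp (t * b n)) \<longlonglongrightarrow> of_real (exp (- (t\<^sup>2 * \<sigma>2 / 2))) * iexp (t * 0)"
    by (rule tendsto_mult)
  then show "(\<lambda>n. char (distr M borel (\<lambda>\<omega>. (\<Sum>i=1..n. X n i \<omega>) + b n)) t)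
      \<longlonglongrightarrow> char (normal_law 0 \<sigma>2) t"
    unfolding \<phi>_def char_distr_add_const[OF rv_sum] char_normal_law[OF pos] by simp
qed

section \<open>Stirling-type estimates for factorials\<close>

text \<open>
  With \<open>F y = y * ln y - y\<close>, an antiderivative of \<open>ln\<close>, the left-hand side is the integral of
  \<open>ln\<close> over the unit interval centred at \<open>c\<close>, so this is the midpoint (Jensen) inequality for
  the concave function \<open>ln\<close>. Summed over \<open>c = 1, \<dots>, m\<close> it gives a lower Stirling bound with the
  correct power of \<open>m\<close>.
\<close>

lemma ln_ge_midpoint:
  fixes c :: real
  assumes "1/2 < c"
  shows "((c + 1/2) * ln (c + 1/2) - (c + 1/2)) - ((c - 1/2) * ln (c - 1/2) - (c - 1/2)) \<le> ln c"
proof -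
  \<comment> \<open>The defect of the inequality on the interval of radius \<open>h\<close>; it grows from \<open>0\<close>.\<close>
  define D where "D h = 2 * h * ln c - ((c + h) * ln (c + h) - (c + h)) + ((c - h) * ln (c - h) - (c - h))" for h
  have "D 0 \<le> D (1/2)"
  proof (rule DERIV_nonneg_imp_nondecreasing[of 0 "1/2" D])
    fix h :: real assume h: "0 \<le> h" "h \<le> 1/2"
    have "((\<lambda>h. (c + h) * ln (c + h) - (c + h)) has_real_derivative ln (c + h)) (at h)"
      using assms h by (auto intro!: derivative_eq_intros)
    moreover have "((\<lambda>h. (c - h) * ln (c - h) - (c - h)) has_real_derivative - ln (c - h)) (at h)"
      using assms h by (auto intro!: derivative_eq_intros)
    ultimately have "(D has_real_derivative (2 * ln c - ln (c + h) - ln (c - h))) (at h)"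
      unfolding D_def using assms h by (auto intro!: derivative_eq_intros)
    moreover have "ln (c + h) + ln (c - h) \<le> 2 * ln c"
    proof -
      have "ln (c + h) + ln (c - h) = ln ((c + h) * (c - h))"
        using assms h by (simp add: ln_mult)
      also have "\<dots> \<le> ln (c * c)"
      proof (rule ln_mono)
        show "0 < (c + h) * (c - h)"
          using assms h by (intro mult_pos_pos) auto
      qed (use assms in \<open>simp_all add: algebra_simps\<close>)
      also have "\<dots> = 2 * ln c"
        using assms by (simp add: ln_mult)
      finally show ?thesis .
    qed
    ultimately show "\<exists>y. (D has_real_derivative y) (at h) \<and> 0 \<le> y"
      by (intro exI[of _ "2 * ln c - ln (c + h) - ln (c - h)"]) auto
  qed simp
  then show ?thesis
    by (simp add: D_def)
qed

lemma ln_fact_ge: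
  "(real m + 1/2) * ln (real m + 1/2) - real m \<le> ln (fact m)"
proof (induction m)
  case 0
  then show ?case by simp
next
  case (Suc m)
  have "ln (fact (Suc m) :: real) = ln (real m + 1) + ln (fact m)"
    by (simp add: ln_mult add.commute)
  moreover have "(real m + 3/2) * ln (real m + 3/2) - (real m + 1/2) * ln (real m + 1/2) - 1 \<le> ln (real m + 1)"
    using ln_ge_midpoint[of "real m + 1"] by (simp add: algebra_simps)
  moreover have "real (Suc m) + 1/2 = real m + 3/2" "real (Suc m) = real m + 1"
    by simp_all
  ultimately show ?case
    using Suc.IH by (simp only:)
qed

text \<open>
  A Poisson probability at \<open>m\<close> is of order at most \<open>1 / sqrt m\<close>, whatever the parameter: the
  left-hand side is largest at \<open>u = m\<close>, where \<open>ln_fact_ge\<close> applies. The square root is what makes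
  the kernel of the estimator as small as \<open>sqrt a\<close>.
\<close>

lemma power_exp_sqrt_le_fact:
  fixes u :: real
  assumes "0 \<le> u" "1 \<le> m"
  shows "u ^ m * exp (- u) * sqrt (real m) \<le> fact m"
proof (cases "u = 0")
  case True
  then show ?thesis using assms by (simp add: power_0_left)
next
  case False
  then have u: "0 < u" using assms by simp
  have m: "0 < real m" using assms by simp
  have "ln (u / real m) \<le> u / real m - 1"
    using u m by (intro ln_le_minus_one) auto
  then have "real m * ln (u / real m) \<le> real m * (u / real m - 1)"
    using m by (intro mult_left_mono) auto
  then have "real m * ln u - u \<le> real m * ln (real m) - real m"
    using u m by (simp add: ln_div algebra_simps)
  moreover have "(real m + 1/2) * ln (real m) \<le> (real m + 1/2) * ln (real m + 1/2)"
    using m by (intro mult_left_mono) auto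
  ultimately have "real m * ln u - u + ln (real m) / 2 \<le> ln (fact m)"
    using ln_fact_ge[of m] by (simp add: algebra_simps)
  moreover have "ln (u ^ m * exp (- u) * sqrt (real m)) = real m * ln u - u + ln (real m) / 2"
    using u m by (simp add: ln_mult ln_realpow ln_sqrt)
  ultimately show ?thesis
    using u m by (subst ln_le_cancel_iff[symmetric]) auto
qed

text \<open>
  The central binomial coefficient divided by \<open>4 ^ m\<close> is \<open>pochhammer (1/2) m / fact m\<close>, and this
  is the reciprocal of Euler's product for \<open>Gamma (1/2) = sqrt pi\<close> up to the factor \<open>sqrt m\<close>.
\<close>

lemma central_binomial_asymptotic:
  "(\<lambda>m. fact (2 * m) / (4 ^ m * (fact m)\<^sup>2) * sqrt (real m)) \<longlonglongrightarrow> 1 / sqrt pi"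
proof -
  have "(\<lambda>m. inverse (Gamma_series' (1/2 :: real) m)) \<longlonglongrightarrow> inverse (Gamma (1/2))"
    by (intro tendsto_inverse Gamma_series'_LIMSEQ) (simp add: Gamma_one_half_real)
  then have L: "(\<lambda>m. inverse (Gamma_series' (1/2 :: real) m)) \<longlonglongrightarrow> 1 / sqrt pi"
    by (simp add: Gamma_one_half_real inverse_eq_divide)
  show ?thesis
  proof (rule Lim_transform_eventually[OF L])
    show "\<forall>\<^sub>F m in sequentially. inverse (Gamma_series' (1/2 :: real) m) =
        fact (2 * m) / (4 ^ m * (fact m)\<^sup>2) * sqrt (real m)"
      using eventually_gt_at_top[of 0]
    proof eventually_elim
      case (elim m)
      define r where "r = sqrt (real m)"
      have r: "r > 0" "r * r = real m" using elim by (auto simp: r_def)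
      have "exp (1/2 * ln (real m)) = r"
        using elim by (simp add: r_def ln_sqrt[symmetric] )
      moreover have "(fact m :: real) = r * r * fact (m - 1)"
        using elim r by (simp add: fact_reduce)
      ultimately show ?case
        using r elim
        by (simp add: Gamma_series'_def fact_double power_mult power2_eq_square
            flip: r_def) (simp add: field_simps)
    qed
  qed
qed

section \<open>Smoothing a function by Gamma densities\<close>

text \<open>
  The derivative \<open>f1\<close> is Lipschitz with constant \<open>B\<close>, so the derivative of
  \<open>\<lambda>t. f t - f1 x * t\<close> is at most \<open>B * \<bar>y - x\<bar>\<close> between \<open>x\<close> and \<open>y\<close>. Two mean value estimates treat
  the one-sided derivative at \<open>0\<close> like any other; the resulting constant is twice the optimal
  \<open>B / 2\<close>, which does not affect rates.
\<close>

lemma C2_on_halfline_taylor_bound: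
  assumes C2: "C2_on_halfline_with_derivs f f1 f2"
    and B: "\<And>t. 0 \<le> t \<Longrightarrow> \<bar>f2 t\<bar> \<le> B"
    and x: "0 \<le> x" and y: "0 \<le> y"
  shows "\<bar>f y - f x - f1 x * (y - x)\<bar> \<le> B * (y - x)\<^sup>2"
proof -
  have B0: "0 \<le> B" using B[of 0] by linarith
  have d: "(f has_real_derivative f1 t) (at t within {0..})" if "0 \<le> t" for t
    using C2 that unfolding C2_on_halfline_with_derivs_def by blast
  have d1: "(f1 has_real_derivative f2 t) (at t within {0..})" if "0 \<le> t" for t
    using C2 that unfolding C2_on_halfline_with_derivs_def by blast
  have lip: "\<bar>f1 t - f1 x\<bar> \<le> B * \<bar>t - x\<bar>" if "0 \<le> t" for t
    using field_differentiable_bound[of "{0..}" f1 f2 B t x] d1 B that x by auto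
  have sub: "closed_segment x y \<subseteq> {0..}"
    using x y by (intro closed_segment_subset) auto
  let ?h = "\<lambda>t. f t - f1 x * t"
  have "norm (?h y - ?h x) \<le> (B * \<bar>y - x\<bar>) * norm (y - x)"
  proof (rule field_differentiable_bound[where S = "closed_segment x y" and f' = "\<lambda>t. f1 t - f1 x"])
    fix t assume t: "t \<in> closed_segment x y"
    then have t0: "0 \<le> t" using sub by auto
    have "(f has_real_derivative f1 t) (at t within closed_segment x y)"
      using DERIV_subset[OF d[OF t0] sub] .
    then show "(?h has_real_derivative f1 t - f1 x) (at t within closed_segment x y)"
      by (auto intro!: derivative_eq_intros)
    have "\<bar>t - x\<bar> \<le> \<bar>y - x\<bar>"
      using t by (auto simp: closed_segment_eq_real_ivl split: if_splits)
    then have "B * \<bar>t - x\<bar> \<le> B * \<bar>y - x\<bar>"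
      using B0 by (intro mult_left_mono)
    then show "norm (f1 t - f1 x) \<le> B * \<bar>y - x\<bar>"
      using lip[OF t0] by simp
  qed auto
  then show ?thesis
    by (simp add: algebra_simps power2_eq_square flip: abs_mult)
qed

lemma has_bochner_integral_erlang_moment:
  assumes "0 < l"
  shows "has_bochner_integral lborel (\<lambda>y. erlang_density k l y * y ^ i)
           (fact (k + i) / (fact k * l ^ i))"
proof (rule has_bochner_integral_nn_integral)
  show "AE y in lborel. 0 \<le> erlang_density k l y * y ^ i"
    using assms by (auto simp: erlang_density_def)
qed (use assms in \<open>auto simp: nn_integral_erlang_ith_moment\<close>)

text \<open>
  Integrating a function against a density with mean \<open>\<mu>\<close> and second moment \<open>q\<close> about \<open>x\<close>: the
  linear Taylor term contributes \<open>d * (\<mu> - x)\<close> and the remainder at most \<open>B * q\<close>. The quadratic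
  bound on the remainder, valid on the whole half-line, replaces any separate tail estimate.
\<close>

lemma erlang_integral_approx:
  fixes f :: "real \<Rightarrow> real" and k :: nat and l x d B :: real
  assumes l: "0 < l"
    and meas: "(\<lambda>y. indicator {0..} y * f y) \<in> borel_measurable borel"
    and taylor: "\<And>y. 0 \<le> y \<Longrightarrow> \<bar>f y - f x - d * (y - x)\<bar> \<le> B * (y - x)\<^sup>2"
  defines "\<mu> \<equiv> (real k + 1) / l"
  defines "q \<equiv> (real k + 1) * (real k + 2) / l\<^sup>2 - 2 * x * \<mu> + x\<^sup>2"
  shows "\<bar>(LINT y|lborel. erlang_density k l y * f y) - f x\<bar> \<le> \<bar>d\<bar> * \<bar>\<mu> - x\<bar> + B * q"
proof -
  let ?e = "erlang_density k l"
  note mom = has_bochner_integral_erlang_moment[OF l, of k]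
  have e0: "has_bochner_integral lborel ?e 1"
    using mom[of 0] l by simp
  have e1: "has_bochner_integral lborel (\<lambda>y. ?e y * y) \<mu>"
    using mom[of 1] l by (simp add: \<mu>_def add.commute)
  have "(fact (k + 2) :: real) = fact k * ((real k + 1) * (real k + 2))"
    by (simp add: algebra_simps)
  then have e2: "has_bochner_integral lborel (\<lambda>y. ?e y * y\<^sup>2) ((real k + 1) * (real k + 2) / l\<^sup>2)"
    using mom[of 2] l by simp
  have lin: "has_bochner_integral lborel (\<lambda>y. ?e y * (f x + d * (y - x))) (f x + d * (\<mu> - x))"
  proof -
    have "has_bochner_integral lborel (\<lambda>y. ?e y * (f x - d * x) + (?e y * y) * d)
        (1 * (f x - d * x) + \<mu> * d)"
      by (intro has_bochner_integral_add has_bochner_integral_mult_left e0 e1)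
    then show ?thesis
      by (simp add: algebra_simps)
  qed
  have quad: "has_bochner_integral lborel (\<lambda>y. B * (?e y * (y - x)\<^sup>2)) (B * q)"
  proof -
    have "has_bochner_integral lborel (\<lambda>y. B * (?e y * y\<^sup>2 - (?e y * y) * (2 * x) + ?e y * x\<^sup>2))
        (B * ((real k + 1) * (real k + 2) / l\<^sup>2 - \<mu> * (2 * x) + 1 * x\<^sup>2))"
      by (intro has_bochner_integral_add has_bochner_integral_diff has_bochner_integral_mult_left
          has_bochner_integral_mult_right e0 e1 e2)
    then show ?thesis
      by (simp add: algebra_simps q_def power2_eq_square)
  qed
  define R where "R y = f y - f x - d * (y - x)" for y
  \<comment> \<open>Only the restriction of \<open>f\<close> to the half-line is known to be measurable.\<close>
  have R_eq: "?e y * R y = ?e y * (indicator {0..} y * f y) - ?e y * (f x + d * (y - x))" for y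
    by (auto simp: R_def erlang_density_def indicator_def algebra_simps)
  have R_meas: "(\<lambda>y. ?e y * R y) \<in> borel_measurable lborel"
    unfolding R_eq using meas by simp
  have R_le: "norm (?e y * R y) \<le> B * (?e y * (y - x)\<^sup>2)" for y
  proof (cases "0 \<le> y")
    case True
    have "\<bar>?e y * R y\<bar> = ?e y * \<bar>R y\<bar>"
      using l by (simp add: abs_mult)
    also have "\<dots> \<le> ?e y * (B * (y - x)\<^sup>2)"
      using taylor[OF True] l by (intro mult_left_mono) (auto simp: R_def)
    finally show ?thesis by (simp add: mult_ac)
  qed (simp add: erlang_density_def)
  have R_int: "integrable lborel (\<lambda>y. ?e y * R y)"
  proof (rule Bochner_Integration.integrable_bound[OF _ R_meas])
    show "integrable lborel (\<lambda>y. B * (?e y * (y - x)\<^sup>2))"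
      using quad unfolding has_bochner_integral_iff by blast
    show "AE y in lborel. norm (?e y * R y) \<le> norm (B * (?e y * (y - x)\<^sup>2))"
      using R_le by (intro AE_I2) (metis abs_ge_self order_trans real_norm_def)
  qed
  have "\<bar>LINT y|lborel. ?e y * R y\<bar> \<le> (LINT y|lborel. norm (?e y * R y))"
    using integral_norm_bound[of lborel "\<lambda>y. ?e y * R y"] by simp
  also have "\<dots> \<le> (LINT y|lborel. B * (?e y * (y - x)\<^sup>2))"
    using R_int quad R_le unfolding has_bochner_integral_iff
    by (intro integral_mono integrable_norm) blast+
  also have "\<dots> = B * q"
    using quad by (simp only: has_bochner_integral_iff)
  finally have R_bound: "\<bar>LINT y|lborel. ?e y * R y\<bar> \<le> B * q" .
  have split: "?e y * f y = ?e y * (f x + d * (y - x)) + ?e y * R y" for y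
    by (simp add: R_def algebra_simps)
  have "(LINT y|lborel. ?e y * f y) = (f x + d * (\<mu> - x)) + (LINT y|lborel. ?e y * R y)"
    unfolding split using lin R_int unfolding has_bochner_integral_iff
    by (subst Bochner_Integration.integral_add) (blast, blast, simp)
  then show "\<bar>(LINT y|lborel. ?e y * f y) - f x\<bar> \<le> \<bar>d\<bar> * \<bar>\<mu> - x\<bar> + B * q"
    using R_bound by (simp add: abs_mult[symmetric])
qed

text \<open>
  The Gamma law with shape \<open>a\<close> and rate \<open>a / x\<close> has mean \<open>x\<close> and variance \<open>x\<^sup>2 / a\<close>, so the linear
  Taylor term disappears. This is the bias of the estimator.
\<close>

lemma erlang_smoothing_same_mean:
  fixes f :: "real \<Rightarrow> real" and a :: nat and x d B :: real
  assumes x: "0 < x" and a: "1 \<le> a"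
    and meas: "(\<lambda>y. indicator {0..} y * f y) \<in> borel_measurable borel"
    and taylor: "\<And>y. 0 \<le> y \<Longrightarrow> \<bar>f y - f x - d * (y - x)\<bar> \<le> B * (y - x)\<^sup>2"
  shows "\<bar>(LINT y|lborel. erlang_density (a - 1) (real a / x) y * f y) - f x\<bar> \<le> B * (x\<^sup>2 / real a)"
proof -
  have l: "0 < real a / x" using x a by simp
  have k: "real (a - 1) + 1 = real a" "real (a - 1) + 2 = real a + 1"
    using a by (simp_all add: of_nat_diff)
  have mean: "real a / (real a / x) = x"
    using x a by simp
  have q: "real a * (real a + 1) / (real a / x)\<^sup>2 - 2 * x * x + x\<^sup>2 = x\<^sup>2 / real a"
    using x a by (simp add: field_simps power2_eq_square)
  show ?thesis
    using erlang_integral_approx[OF l meas taylor, of "a - 1"] unfolding k mean q by simp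
qed

text \<open>
  The Gamma law with shape \<open>2 * a - 2\<close> and rate \<open>2 * a / x\<close> has mean \<open>x * (1 - 1 / a)\<close>; it misses \<open>x\<close>
  by \<open>x / a\<close>, which is harmless here since this integral enters the variance and needs only a limit.
\<close>

lemma erlang_smoothing_double_shape:
  fixes f :: "real \<Rightarrow> real" and a :: nat and x d B :: real
  assumes x: "0 < x" and a: "2 \<le> a" and B: "0 \<le> B"
    and meas: "(\<lambda>y. indicator {0..} y * f y) \<in> borel_measurable borel"
    and taylor: "\<And>y. 0 \<le> y \<Longrightarrow> \<bar>f y - f x - d * (y - x)\<bar> \<le> B * (y - x)\<^sup>2"
  shows "\<bar>(LINT y|lborel. erlang_density (2 * a - 3) (2 * real a / x) y * f y) - f x\<bar>
           \<le> (\<bar>d\<bar> * x + B * x\<^sup>2) / real a"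
proof -
  have l: "0 < 2 * real a / x" using x a by simp
  have k: "real (2 * a - 3) + 1 = 2 * real a - 2" "real (2 * a - 3) + 2 = 2 * real a - 1"
    using a by (simp_all add: of_nat_diff)
  have mean: "(2 * real a - 2) / (2 * real a / x) = x - x / real a"
    using x a by (simp add: field_simps)
  have "(2 * real a - 2) * (2 * real a - 1) / (2 * real a / x)\<^sup>2 - 2 * x * (x - x / real a) + x\<^sup>2
      = x\<^sup>2 / real a * (1 / 2 + 1 / (2 * real a))"
    using x a by (simp add: field_simps power2_eq_square)
  also have "\<dots> \<le> x\<^sup>2 / real a * 1"
    using a by (intro mult_left_mono) (auto simp: field_simps)
  finally have q: "(2 * real a - 2) * (2 * real a - 1) / (2 * real a / x)\<^sup>2
      - 2 * x * (x - x / real a) + x\<^sup>2 \<le> x\<^sup>2 / real a"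
    by simp
  have "\<bar>(LINT y|lborel. erlang_density (2 * a - 3) (2 * real a / x) y * f y) - f x\<bar>
      \<le> \<bar>d\<bar> * \<bar>x - x / real a - x\<bar> + B * ((2 * real a - 2) * (2 * real a - 1) / (2 * real a / x)\<^sup>2
        - 2 * x * (x - x / real a) + x\<^sup>2)"
    using erlang_integral_approx[OF l meas taylor, of "2 * a - 3"] unfolding k mean by simp
  also have "\<dots> \<le> \<bar>d\<bar> * (x / real a) + B * (x\<^sup>2 / real a)"
    using x B q by (intro add_mono mult_left_mono) auto
  finally show ?thesis
    by (simp add: add_divide_distrib)
qed

section \<open>The kernel of the estimator\<close>

definition gamma_kernel :: "real \<Rightarrow> nat \<Rightarrow> real \<Rightarrow> real \<Rightarrow> real" where
  "gamma_kernel W a x y =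
     W / y\<^sup>2 * (1 / Gamma (real a) * (real a * y / x) ^ a * exp (- (real a / x) * y))"

text \<open>
  The total mass of \<open>y \<mapsto> length_biased_density f W y * (gamma_kernel W a x y)\<^sup>2 / f y\<close>, which is a
  multiple of a Gamma density of shape \<open>2 * a - 2\<close>; the factorials come from the normalizing
  constants of that density and of the kernel.
\<close>

definition kernel_sq_factor :: "real \<Rightarrow> nat \<Rightarrow> real \<Rightarrow> real" where
  "kernel_sq_factor W a x =
     W * (real a / x)\<^sup>2 * fact (2 * a - 3) / (4 ^ (a - 1) * (fact (a - 1))\<^sup>2)"

lemma measurable_gamma_kernel [measurable]: "gamma_kernel W a x \<in> borel_measurable borel"
  unfolding gamma_kernel_def[abs_def] by measurable

lemma gamma_estimator_eq_mean:
  "gamma_estimator W n a y x = 1 / real n * (\<Sum>i=1..n. gamma_kernel W a x (y i))"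
  by (simp add: gamma_estimator_def gamma_kernel_def)

lemma gamma_kernel_Suc_Suc:
  fixes x y W :: real and k :: nat
  assumes "0 < y" "0 < x"
  defines "l \<equiv> real (Suc (Suc k)) / x"
  shows "gamma_kernel W (Suc (Suc k)) x y = W * l\<^sup>2 / fact (Suc k) * ((l * y) ^ k * exp (- (l * y)))"
proof -
  have "Gamma (real (Suc (Suc k))) = fact (Suc k)"
    using Gamma_fact[of "Suc k", where ?'a=real] by (simp add: add_ac)
  moreover have "real (Suc (Suc k)) * y / x = l * y"
    by (simp add: l_def)
  ultimately have "gamma_kernel W (Suc (Suc k)) x y
      = W / y\<^sup>2 * (1 / fact (Suc k) * (l * y) ^ Suc (Suc k) * exp (- (l * y)))"
    unfolding gamma_kernel_def by (simp only: l_def) simp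
  also have "(l * y) ^ Suc (Suc k) = l\<^sup>2 * y\<^sup>2 * (l * y) ^ k"
    by (simp add: power2_eq_square)
  finally show ?thesis
    using assms(1) by simp
qed

text \<open>
  The weight \<open>W / y\<^sup>2\<close> is designed for this cancellation: it removes the length bias \<open>y / W\<close> and
  lowers the exponent by one more, leaving the Gamma density with shape \<open>a\<close> and rate \<open>a / x\<close>.
  In \<open>erlang_density k l\<close> the shape is \<open>k + 1\<close>. The case \<open>a = 1\<close> is excluded because of the value at
  \<open>y = 0\<close>, where the kernel is \<open>0\<close> by division by zero and the Gamma density is \<open>0\<close> only for
  shape at least 2.
\<close>

lemma length_biased_times_kernel:
  assumes "0 < x" "W \<noteq> 0" "2 \<le> a"
  shows "length_biased_density f W y * gamma_kernel W a x y
           = erlang_density (a - 1) (real a / x) y * f y"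
proof (cases "0 < y")
  case True
  obtain k where a: "a = Suc (Suc k)"
    using assms(3) by (metis add_2_eq_Suc le_Suc_ex)
  define l where "l = real a / x"
  have kernel: "gamma_kernel W a x y = W * l\<^sup>2 / fact (Suc k) * ((l * y) ^ k * exp (- (l * y)))"
    unfolding a l_def by (rule gamma_kernel_Suc_Suc[OF True assms(1)])
  have "a - 1 = Suc k" by (simp add: a)
  then show ?thesis
    using True assms(2)
    by (simp add: kernel length_biased_density_def erlang_density_def power_mult_distrib
        power2_eq_square del: fact_Suc flip: l_def)
next
  case False
  then show ?thesis
    using assms(3) by (cases "y = 0") (auto simp: length_biased_density_def erlang_density_def)
qed

text \<open>
  Squaring doubles the exponent and the rate of the kernel, so the second moment is again an
  integral of \<open>f\<close> against a Gamma density, now of shape \<open>2 * a - 2\<close> and rate \<open>2 * a / x\<close>.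
\<close>

lemma length_biased_times_kernel_sq:
  assumes "0 < x" "W \<noteq> 0" "2 \<le> a"
  shows "length_biased_density f W y * (gamma_kernel W a x y)\<^sup>2
           = kernel_sq_factor W a x * (erlang_density (2 * a - 3) (2 * real a / x) y * f y)"
proof (cases "0 < y")
  case True
  obtain k where a: "a = Suc (Suc k)"
    using assms(3) by (metis add_2_eq_Suc le_Suc_ex)
  define l where "l = real a / x"
  have l2: "2 * real a / x = 2 * l"
    by (simp add: l_def)
  have idx: "2 * a - 3 = 2 * k + 1" "a - 1 = k + 1"
    by (simp_all add: a)
  have exps: "exp (- (2 * l) * y) = exp (- (l * y)) * exp (- (l * y))"
    by (simp flip: exp_add)
  have pow: "(2 * l) ^ Suc (2 * k + 1) = 4 ^ (k + 1) * (l * l * (l ^ k * l ^ k))"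
  proof -
    have "Suc (2 * k + 1) = 2 * (k + 1)" by simp
    then have "(2 * l) ^ Suc (2 * k + 1) = ((2 * l)\<^sup>2) ^ (k + 1)"
      by (simp only: power_mult)
    also have "(2 * l)\<^sup>2 = 4 * (l * l)"
      by (simp add: power2_eq_square)
    also have "(4 * (l * l)) ^ (k + 1) = 4 ^ (k + 1) * (l * l * (l ^ k * l ^ k))"
      by (simp only: power_mult_distrib power_add power_one_right mult_ac)
    finally show ?thesis .
  qed
  have ypow: "y ^ (2 * k + 1) = y * (y ^ k * y ^ k)"
    by (simp only: mult_2 mult_2_right power_add power_one_right mult.commute)
  have kernel: "gamma_kernel W a x y = W * l\<^sup>2 / fact (k + 1) * ((l * y) ^ k * exp (- (l * y)))"
    unfolding a l_def using gamma_kernel_Suc_Suc[OF True assms(1), of W k] by simp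
  define E P Q where "E = exp (- (l * y))" and "P = y ^ k" and "Q = l ^ k"
  define F G H :: real where "F = fact (k + 1)" and "G = fact (2 * k + 1)" and "H = 4 ^ (k + 1)"
  have nz: "F \<noteq> 0" "G \<noteq> 0" "H \<noteq> 0"
    by (simp_all add: F_def G_def H_def)
  have lhs: "length_biased_density f W y * (gamma_kernel W a x y)\<^sup>2
      = (1 / W * (y * f y)) * (W * l\<^sup>2 / F * (Q * P * E))\<^sup>2"
    unfolding kernel length_biased_density_def E_def P_def Q_def F_def
    using True by (simp only: power_mult_distrib) simp
  have erl: "erlang_density (2 * k + 1) (2 * l) y
      = H * (l * l * (Q * Q)) * (y * (P * P)) * (E * E) / G"
    unfolding erlang_density_def pow ypow exps E_def P_def Q_def G_def H_def using True by simp
  have factor: "kernel_sq_factor W a x = W * l\<^sup>2 * G / (H * F\<^sup>2)"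
    unfolding kernel_sq_factor_def idx F_def G_def H_def l_def ..
  show ?thesis
    unfolding lhs l2 idx erl factor using nz assms(2)
    by (simp add: power2_eq_square)
next
  case False
  then show ?thesis
    using assms(3) by (cases "y = 0") (auto simp: length_biased_density_def erlang_density_def)
qed

text \<open>
  In the variable \<open>u = a * y / x\<close> the kernel is \<open>W * (a / x)\<^sup>2 / (a - 1)!\<close> times
  \<open>u ^ (a - 2) * exp (- u)\<close>, and \<open>power_exp_sqrt_le_fact\<close> bounds it by a constant times
  \<open>a\<^sup>2 / ((a - 1) * sqrt (a - 2))\<close>. The order \<open>sqrt a\<close> is sharp; after normalization it is exactly what
  makes the summands vanish whenever \<open>\<delta> < 2\<close>.
\<close>

lemma gamma_kernel_bounds:
  assumes "0 < x" "0 < W" "3 \<le> a" "0 \<le> y"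
  shows "0 \<le> gamma_kernel W a x y"
    and "gamma_kernel W a x y \<le> 3 * W / x\<^sup>2 * sqrt (real a)"
proof -
  show "0 \<le> gamma_kernel W a x y"
    using assms unfolding gamma_kernel_def
    by (intro mult_nonneg_nonneg divide_nonneg_nonneg zero_le_power) (auto intro!: Gamma_real_nonneg)
  show "gamma_kernel W a x y \<le> 3 * W / x\<^sup>2 * sqrt (real a)"
  proof (cases "y = 0")
    case True
    then show ?thesis using assms by (simp add: gamma_kernel_def)
  next
    case False
    then have y: "0 < y" using assms by simp
    obtain k where a: "a = Suc (Suc k)" and k: "1 \<le> k"
      using assms(3) by (metis Suc_le_D Suc_le_mono numeral_3_eq_3 One_nat_def)
    define l where "l = real a / x"
    define s where "s = sqrt (real k)"
    have s: "0 < s" using k by (simp add: s_def)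
    have ly: "0 \<le> l * y" using assms y by (simp add: l_def)
    have peak: "(l * y) ^ k * exp (- (l * y)) \<le> fact k / s"
      using power_exp_sqrt_le_fact[OF ly k] s by (simp add: field_simps s_def)
    (* As k >= 1, both a = k + 2 <= 4 * k and a <= 3/2 * (k + 1). *)
    have "sqrt (real a) \<le> sqrt (4 * real k)"
      using k by (intro real_sqrt_le_mono) (simp add: a)
    then have "sqrt (real a) \<le> 2 * s"
      by (simp add: s_def real_sqrt_mult)
    moreover have "real a \<le> 3 / 2 * (real k + 1)"
      using k by (simp add: a)
    ultimately have "real a * sqrt (real a) \<le> (3 / 2 * (real k + 1)) * (2 * s)"
      by (intro mult_mono) auto
    then have "sqrt (real a) * (real a * sqrt (real a)) \<le> sqrt (real a) * (3 * (real k + 1) * s)"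
      by (intro mult_left_mono) auto
    moreover have "sqrt (real a) * (real a * sqrt (real a)) = (real a)\<^sup>2"
      by (simp add: power2_eq_square)
    ultimately have ratio: "(real a)\<^sup>2 / ((real k + 1) * s) \<le> 3 * sqrt (real a)"
      using s k by (simp add: divide_le_eq mult_ac)
    have "gamma_kernel W a x y = W * l\<^sup>2 / fact (Suc k) * ((l * y) ^ k * exp (- (l * y)))"
      unfolding a l_def by (rule gamma_kernel_Suc_Suc[OF y assms(1)])
    also have "\<dots> \<le> W * l\<^sup>2 / fact (Suc k) * (fact k / s)"
      using assms peak by (intro mult_left_mono) auto
    also have "\<dots> = W / x\<^sup>2 * ((real a)\<^sup>2 / ((real k + 1) * s))"
      by (simp add: l_def power_divide add.commute)
    also have "\<dots> \<le> W / x\<^sup>2 * (3 * sqrt (real a))"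
      using assms ratio by (intro mult_left_mono) auto
    finally show ?thesis by (simp add: mult_ac)
  qed
qed

text \<open>
  With \<open>m = a - 1\<close>, the factorials form the central binomial coefficient:
  \<open>fact (2 * a - 3) = fact (2 * m) / (2 * m)\<close>. Hence the factor is of order
  \<open>a\<^sup>2 / m * m powr (-1/2)\<close>, that is \<open>sqrt a\<close>, and the constant \<open>sqrt pi\<close> of the limiting variance
  is the one of the central binomial coefficient.
\<close>

lemma kernel_sq_factor_asymptotic:
  "(\<lambda>a. kernel_sq_factor W a x / sqrt (real a)) \<longlonglongrightarrow> W / (2 * x\<^sup>2 * sqrt pi)"
proof -
  let ?p = "\<lambda>m. fact (2 * m) / (4 ^ m * (fact m)\<^sup>2) * sqrt (real m)"
  have "(\<lambda>m. W / (2 * x\<^sup>2) * (sqrt (1 + 1 / real m) ^ 3 * ?p m))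
      \<longlonglongrightarrow> W / (2 * x\<^sup>2) * (sqrt (1 + 0) ^ 3 * (1 / sqrt pi))"
    by (intro tendsto_intros central_binomial_asymptotic lim_1_over_n)
  then have L: "(\<lambda>m. W / (2 * x\<^sup>2) * (sqrt (1 + 1 / real m) ^ 3 * ?p m))
      \<longlonglongrightarrow> W / (2 * x\<^sup>2 * sqrt pi)"
    by simp
  have "\<forall>\<^sub>F m in sequentially. W / (2 * x\<^sup>2) * (sqrt (1 + 1 / real m) ^ 3 * ?p m)
      = kernel_sq_factor W (Suc m) x / sqrt (real (Suc m))"
    using eventually_gt_at_top[of 0]
  proof eventually_elim
    case (elim m)
    define r s where "r = sqrt (real m)" and "s = sqrt (real (Suc m))"
    have rs: "0 < r" "0 < s" "r * r = real m" "s * s = real (Suc m)"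
      using elim by (auto simp: r_def s_def)
    have quot: "sqrt (1 + 1 / real m) = s / r"
      using elim by (simp add: r_def s_def field_simps flip: real_sqrt_divide)
    have "2 * m = Suc (2 * Suc m - 3)"
      using elim by simp
    then have F: "(fact (2 * m) :: real) = 2 * (r * r) * fact (2 * Suc m - 3)"
      unfolding rs by (metis fact_Suc of_nat_mult of_nat_numeral)
    have "kernel_sq_factor W (Suc m) x / s
        = W * (s * s / x)\<^sup>2 * fact (2 * Suc m - 3) / (4 ^ m * (fact m)\<^sup>2) / s"
      unfolding kernel_sq_factor_def rs by simp
    also have "\<dots> = W / (2 * x\<^sup>2) * ((s / r) ^ 3 * (fact (2 * m) / (4 ^ m * (fact m)\<^sup>2) * r))"
      unfolding F using rs(1,2)
      by (simp add: power_divide power_mult_distrib power2_eq_square power3_eq_cube)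
    finally show ?case
      unfolding quot by (simp add: r_def s_def)
  qed
  from Lim_transform_eventually[OF L this] show ?thesis
    by (rule LIMSEQ_imp_Suc)
qed

section \<open>Asymptotic normality of the estimator\<close>

text \<open>
  The two null sequences are the size of a normalized summand and the size of the normalized
  bias. They are powers of \<open>\<alpha> n / n\<^sup>2\<close> and of \<open>n powr (2/5) / \<alpha> n\<close>, and so correspond to the
  upper and to the lower bound on \<open>\<delta>\<close>.
\<close>

lemma shape_rate_consequences:
  fixes \<alpha> :: "nat \<Rightarrow> nat" and \<delta> :: real
  assumes asymp: "(\<lambda>n. real (\<alpha> n)) \<sim>[at_top] (\<lambda>n. real n powr \<delta>)"
    and delta: "2 / 5 < \<delta>" "\<delta> < 2"
  shows "filterlim \<alpha> at_top sequentially"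
    and "(\<lambda>n. real (\<alpha> n) powr (1/4) / real n powr (1/2)) \<longlonglongrightarrow> 0"
    and "(\<lambda>n. real n powr (1/2) / real (\<alpha> n) powr (5/4)) \<longlonglongrightarrow> 0"
proof -
  have ratio: "(\<lambda>n. real (\<alpha> n) / real n powr \<delta>) \<longlonglongrightarrow> 1"
    by (intro asymp_equivD_strong[OF asymp] eventually_mono[OF eventually_gt_at_top[of 0]]) auto
  have "filterlim (\<lambda>n. real n powr \<delta>) at_top at_top"
  proof -
    have "(\<lambda>n. real n powr - \<delta>) \<longlonglongrightarrow> 0"
      using delta by (intro tendsto_neg_powr filterlim_real_sequentially) auto
    then have "filterlim (\<lambda>n. inverse (real n powr - \<delta>)) at_top sequentially"
      by (rule filterlim_inverse_at_top) (auto intro: eventually_mono[OF eventually_gt_at_top[of 0]])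
    then show ?thesis
      by (simp add: powr_minus)
  qed
  then have "filterlim (\<lambda>n. real (\<alpha> n)) at_top at_top"
    using asymp by (metis asymp_equiv_at_top_transfer asymp_equiv_sym)
  then show top: "filterlim \<alpha> at_top sequentially"
    by (simp add: filterlim_sequentially_iff_filterlim_real)
  have "(\<lambda>n. (real (\<alpha> n) / real n powr \<delta>) * real n powr (\<delta> - 2)) \<longlonglongrightarrow> 1 * 0"
    using delta by (intro tendsto_mult ratio tendsto_neg_powr filterlim_real_sequentially) auto
  moreover have "\<forall>\<^sub>F n in sequentially.
      (real (\<alpha> n) / real n powr \<delta>) * real n powr (\<delta> - 2) = real (\<alpha> n) / real n powr 2"
    using eventually_gt_at_top[of 0]
    by eventually_elim (simp add: powr_diff)
  ultimately have "(\<lambda>n. real (\<alpha> n) / real n powr 2) \<longlonglongrightarrow> 1 * 0"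
    by (rule Lim_transform_eventually)
  then have small: "(\<lambda>n. real (\<alpha> n) / real n powr 2) \<longlonglongrightarrow> 0"
    by simp
  have "(\<lambda>n. (real (\<alpha> n) / real n powr 2) powr (1/4)) \<longlonglongrightarrow> 0"
    by (rule tendsto_zero_powrI[OF small tendsto_const]) auto
  then show "(\<lambda>n. real (\<alpha> n) powr (1/4) / real n powr (1/2)) \<longlonglongrightarrow> 0"
    by (simp add: powr_divide powr_powr del: powr_numeral)
  have "(\<lambda>n. real n powr (2/5 - \<delta>) / (real (\<alpha> n) / real n powr \<delta>)) \<longlonglongrightarrow> 0 / 1"
    using delta by (intro tendsto_divide ratio tendsto_neg_powr filterlim_real_sequentially) auto
  moreover have "\<forall>\<^sub>F n in sequentially.
      real n powr (2/5 - \<delta>) / (real (\<alpha> n) / real n powr \<delta>) = real n powr (2/5) / real (\<alpha> n)"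
    using eventually_gt_at_top[of 0]
    by eventually_elim (simp add: powr_diff)
  ultimately have "(\<lambda>n. real n powr (2/5) / real (\<alpha> n)) \<longlonglongrightarrow> 0 / 1"
    by (rule Lim_transform_eventually)
  then have large: "(\<lambda>n. real n powr (2/5) / real (\<alpha> n)) \<longlonglongrightarrow> 0"
    by simp
  have "(\<lambda>n. (real n powr (2/5) / real (\<alpha> n)) powr (5/4)) \<longlonglongrightarrow> 0"
    by (rule tendsto_zero_powrI[OF large tendsto_const]) auto
  then show "(\<lambda>n. real n powr (1/2) / real (\<alpha> n) powr (5/4)) \<longlonglongrightarrow> 0"
    by (simp add: powr_divide powr_powr)
qed

theorem theorem4p2:
  fixes f f1 f2 :: "real \<Rightarrow> real" and W x \<delta> :: real
    and M :: "'a measure" and Y :: "nat \<Rightarrow> 'a \<Rightarrow> real" and \<alpha> :: "nat \<Rightarrow> nat"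
  assumes f_density: "prob_density_on_halfline f"
    and mean_finite: "set_integrable lborel {0..} (\<lambda>t. t * f t)"
    and W_eq: "W = (LINT t:{0..}|lborel. t * f t)"
    and W_pos: "0 < W"
    and f_C2: "C2_on_halfline_with_derivs f f1 f2"
    and f2_bounded: "bdd_above ((\<lambda>t. \<bar>f2 t\<bar>) ` {0..})"
    and M_prob: "prob_space M"
    and Y_indep: "prob_space.indep_vars M (\<lambda>_. borel) Y {1..}"
    and Y_density: "\<And>i. i \<ge> 1 \<Longrightarrow>
          distributed M lborel (Y i) (\<lambda>y. ennreal (length_biased_density f W y))"
    and x_pos: "0 < x" and fx_pos: "0 < f x"
    and delta: "2 / 5 < \<delta>" "\<delta> < 2"
    and alpha_pos: "\<And>n. n \<ge> 1 \<Longrightarrow> \<alpha> n \<ge> 1"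
    and alpha_asymp: "(\<lambda>n. real (\<alpha> n)) \<sim>[at_top] (\<lambda>n. real n powr \<delta>)"
  shows "weak_conv_m
           (\<lambda>n. distr M borel (\<lambda>\<omega>. real n powr (1 / 2) / real (\<alpha> n) powr (1 / 4) *
                   (gamma_estimator W n (\<alpha> n) (\<lambda>i. Y i \<omega>) x - f x)))
           (normal_law 0 (W * f x / (2 * x\<^sup>2 * sqrt pi)))"
proof -
  interpret prob_space M by (rule M_prob)
  obtain B where B: "\<And>t. 0 \<le> t \<Longrightarrow> \<bar>f2 t\<bar> \<le> B"
    using f2_bounded by (auto simp: bdd_above_def)
  have B0: "0 \<le> B" using B[of 0] by linarith
  have taylor: "\<bar>f y - f x - f1 x * (y - x)\<bar> \<le> B * (y - x)\<^sup>2" if "0 \<le> y" for y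
    using C2_on_halfline_taylor_bound[OF f_C2 B _ that, of x] x_pos by simp
  have meas: "(\<lambda>y. indicator {0..} y * f y) \<in> borel_measurable borel"
  proof -
    have "integrable lborel (\<lambda>y. indicator {0..} y *\<^sub>R f y)"
      using f_density unfolding prob_density_on_halfline_def set_integrable_def by blast
    from borel_measurable_integrable[OF this] show ?thesis
      by simp
  qed
  have dens0: "0 \<le> length_biased_density f W y" for y
    using f_density W_pos
    by (auto simp: prob_density_on_halfline_def length_biased_density_def indicator_def)
  \<comment> \<open>\<open>m a\<close> is the mean of one summand of the estimator with shape \<open>a\<close>; \<open>m2 a\<close> is its second
    moment divided by \<open>kernel_sq_factor W a x\<close>. Both are smoothed values of \<open>f\<close> at \<open>x\<close>.\<close>
  define m where "m a = (LINT y|lborel. erlang_density (a - 1) (real a / x) y * f y)" for a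
  define m2 where "m2 a = (LINT y|lborel. erlang_density (2 * a - 3) (2 * real a / x) y * f y)" for a
  let ?T = "\<lambda>a. gamma_kernel W a x"
  have rv: "random_variable borel (Y i)" if "1 \<le> i" for i
    using distributed_measurable[OF Y_density[OF that]] by simp
  have Y_nonneg: "AE \<omega> in M. 0 \<le> Y i \<omega>" if "1 \<le> i" for i
    using distributed_AE2[OF Y_density[OF that], of "\<lambda>y. 0 \<le> y"]
    by (simp add: length_biased_density_def indicator_def)
  have mean: "expectation (\<lambda>\<omega>. ?T a (Y i \<omega>)) = m a" if "1 \<le> i" "2 \<le> a" for i a
  proof -
    have "expectation (\<lambda>\<omega>. ?T a (Y i \<omega>)) = (LINT y|lborel. length_biased_density f W y * ?T a y)"
      using dens0 by (intro distributed_integral[OF Y_density[OF that(1)], symmetric]) auto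
    then show ?thesis
      using length_biased_times_kernel[of x W a f] x_pos W_pos that by (simp add: m_def)
  qed
  have second: "expectation (\<lambda>\<omega>. (?T a (Y i \<omega>))\<^sup>2) = kernel_sq_factor W a x * m2 a"
    if "1 \<le> i" "2 \<le> a" for i a
  proof -
    have "expectation (\<lambda>\<omega>. (?T a (Y i \<omega>))\<^sup>2)
        = (LINT y|lborel. length_biased_density f W y * (?T a y)\<^sup>2)"
      using dens0 by (intro distributed_integral[OF Y_density[OF that(1)], symmetric]) auto
    then show ?thesis
      using length_biased_times_kernel_sq[of x W a f] x_pos W_pos that by (simp add: m2_def)
  qed
  have T_bound: "AE \<omega> in M. \<bar>?T a (Y i \<omega>)\<bar> \<le> 3 * W / x\<^sup>2 * sqrt (real a)"
    if "1 \<le> i" "3 \<le> a" for i a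
    using Y_nonneg[OF that(1)]
    by eventually_elim (use gamma_kernel_bounds[OF x_pos W_pos that(2)] in auto)
  have bias: "\<bar>m a - f x\<bar> \<le> B * (x\<^sup>2 / real a)" if "1 \<le> a" for a
    unfolding m_def by (rule erlang_smoothing_same_mean[OF x_pos that meas taylor])
  have inv: "(\<lambda>a. C / real a) \<longlonglongrightarrow> 0" for C :: real
    by (rule real_tendsto_divide_at_top[OF tendsto_const filterlim_real_sequentially])
  have "(\<lambda>a. m a - f x) \<longlonglongrightarrow> 0"
  proof (rule Lim_null_comparison[OF _ inv[of "B * x\<^sup>2"]])
    show "\<forall>\<^sub>F a in sequentially. norm (m a - f x) \<le> B * x\<^sup>2 / real a"
      using eventually_ge_at_top[of 1] by eventually_elim (use bias in simp)
  qed
  then have m_lim: "m \<longlonglongrightarrow> f x"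
    by (simp add: LIM_zero_iff)
  have "(\<lambda>a. m2 a - f x) \<longlonglongrightarrow> 0"
  proof (rule Lim_null_comparison[OF _ inv[of "\<bar>f1 x\<bar> * x + B * x\<^sup>2"]])
    show "\<forall>\<^sub>F a in sequentially. norm (m2 a - f x) \<le> (\<bar>f1 x\<bar> * x + B * x\<^sup>2) / real a"
      using eventually_ge_at_top[of 2]
    proof eventually_elim
      case (elim a)
      show ?case
        unfolding m2_def real_norm_def
        by (rule erlang_smoothing_double_shape[OF x_pos elim B0 meas taylor])
    qed
  qed
  then have m2_lim: "m2 \<longlonglongrightarrow> f x"
    by (simp add: LIM_zero_iff)
  \<comment> \<open>The variance of one summand on the scale \<open>sqrt a\<close>; the squared mean is negligible there.\<close>
  define V where "V a = (kernel_sq_factor W a x * m2 a - (m a)\<^sup>2) / sqrt (real a)" for a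
  define \<sigma>2 where "\<sigma>2 = W * f x / (2 * x\<^sup>2 * sqrt pi)"
  have "(\<lambda>a. kernel_sq_factor W a x / sqrt (real a) * m2 a - (m a)\<^sup>2 / sqrt (real a))
      \<longlonglongrightarrow> W / (2 * x\<^sup>2 * sqrt pi) * f x - 0"
    by (intro tendsto_diff tendsto_mult kernel_sq_factor_asymptotic m2_lim
        real_tendsto_divide_at_top[OF tendsto_power[OF m_lim]]
        filterlim_compose[OF sqrt_at_top filterlim_real_sequentially])
  then have V_lim: "V \<longlonglongrightarrow> \<sigma>2"
    by (simp add: V_def[abs_def] \<sigma>2_def diff_divide_distrib)
  note rates = shape_rate_consequences[OF alpha_asymp delta]
  (* Centring the kernel turns the normalized error into a row sum of an array plus the
     normalized bias b n. The factor sqrt (\<alpha> n) of the uniform bound on the kernel is absorbed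
     into \<epsilon> n; the mean is put there as well, which is possible since 1 <= sqrt (\<alpha> n). *)
  define c where "c n = real n powr (1/2) / real (\<alpha> n) powr (1/4)" for n
  define X where "X n i \<omega> = c n / real n * (?T (\<alpha> n) (Y i \<omega>) - m (\<alpha> n))" for n i \<omega>
  define b where "b n = c n * (m (\<alpha> n) - f x)" for n
  define \<epsilon> where "\<epsilon> n = real (\<alpha> n) powr (1/4) / real n powr (1/2) * (3 * W / x\<^sup>2 + \<bar>m (\<alpha> n)\<bar>)" for n
  have eq: "c n * (gamma_estimator W n (\<alpha> n) (\<lambda>i. Y i \<omega>) x - f x) = (\<Sum>i=1..n. X n i \<omega>) + b n" for n \<omega>
  proof (cases "n = 0")
    case True
    (* Both sides vanish since 0 powr (1/2) = 0. *)
    then show ?thesis by (simp add: c_def b_def)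
  next
    case False
    then show ?thesis
      by (simp add: X_def b_def gamma_estimator_eq_mean right_diff_distrib sum_subtractf
          sum_distrib_left sum_divide_distrib)
  qed
  have large: "\<forall>\<^sub>F n in sequentially. 3 \<le> \<alpha> n \<and> 0 < n"
    using filterlim_at_top[THEN iffD1, OF rates(1), rule_format, of 3] eventually_gt_at_top[of 0]
    by eventually_elim simp
  have scale: "(c n)\<^sup>2 / real n = 1 / sqrt (real (\<alpha> n))"
      "c n / real n * sqrt (real (\<alpha> n)) = real (\<alpha> n) powr (1/4) / real n powr (1/2)"
      "c n / real (\<alpha> n) = real n powr (1/2) / real (\<alpha> n) powr (5/4)"
      "0 \<le> c n"
    if "3 \<le> \<alpha> n \<and> 0 < n" for n
  proof -
    \<comment> \<open>All quantities are monomials in \<open>s\<close> and \<open>r\<close>.\<close>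
    define s r where "s = real n powr (1/2)" and "r = real (\<alpha> n) powr (1/4)"
    have s: "0 < s" "s * s = real n"
      using that by (auto simp: s_def simp flip: powr_add)
    have r: "0 < r" "sqrt (real (\<alpha> n)) = r * r" "real (\<alpha> n) = r * r * r * r"
      using that by (auto simp: r_def powr_half_sqrt[symmetric] simp flip: powr_add)
    have "real (\<alpha> n) powr (5/4) = real (\<alpha> n) * r"
      using powr_add[of "real (\<alpha> n)" 1 "1/4"] that by (simp add: r_def)
    also have "\<dots> = r * r * r * r * r"
      by (subst r(3)) simp
    finally have r5: "real (\<alpha> n) powr (5/4) = r * r * r * r * r" .
    have cn: "c n = s / r"
      by (simp add: c_def s_def r_def)
    show "(c n)\<^sup>2 / real n = 1 / sqrt (real (\<alpha> n))"
      unfolding cn r(2) s(2)[symmetric] using s(1) r(1) by (simp add: power2_eq_square)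
    have "c n / real n * sqrt (real (\<alpha> n)) = r / s"
      unfolding cn r(2) s(2)[symmetric] using s(1) r(1) by simp
    then show "c n / real n * sqrt (real (\<alpha> n)) = real (\<alpha> n) powr (1/4) / real n powr (1/2)"
      unfolding s_def r_def .
    have "c n / real (\<alpha> n) = s / (r * r * r * r * r)"
      unfolding cn by (subst r(3)) simp
    then show "c n / real (\<alpha> n) = real n powr (1/2) / real (\<alpha> n) powr (5/4)"
      unfolding s_def r5 .
    show "0 \<le> c n"
      unfolding cn using s r by simp
  qed
  have "weak_conv_m (\<lambda>n. distr M borel (\<lambda>\<omega>. (\<Sum>i=1..n. X n i \<omega>) + b n)) (normal_law 0 \<sigma>2)"
  proof (rule bounded_triangular_array_clt)
    show "indep_vars (\<lambda>_. borel) (X n) {1..n}" for n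
      unfolding X_def[abs_def]
      by (rule indep_vars_compose2[OF indep_vars_subset[OF Y_indep]]) auto
    have T_int: "integrable M (\<lambda>\<omega>. ?T a (Y i \<omega>))" "integrable M (\<lambda>\<omega>. (?T a (Y i \<omega>))\<^sup>2)"
      if i: "1 \<le> i" and a: "3 \<le> a" for i a
    proof -
      have [measurable]: "random_variable borel (Y i)" by (rule rv[OF i])
      show "integrable M (\<lambda>\<omega>. ?T a (Y i \<omega>))"
        using T_bound[OF i a] by (intro integrable_const_bound) auto
      have "AE \<omega> in M. (?T a (Y i \<omega>))\<^sup>2 \<le> (3 * W / x\<^sup>2 * sqrt (real a))\<^sup>2"
        using T_bound[OF i a] by eventually_elim (metis abs_ge_zero power2_abs power_mono)
      then show "integrable M (\<lambda>\<omega>. (?T a (Y i \<omega>))\<^sup>2)"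
        by (intro integrable_const_bound) auto
    qed
    show "\<forall>\<^sub>F n in sequentially. \<forall>i\<in>{1..n}. expectation (X n i) = 0"
      using large
    proof eventually_elim
      case (elim n)
      show ?case
        unfolding X_def using elim T_int mean by (auto simp: prob_space)
    qed
    show "\<forall>\<^sub>F n in sequentially. \<forall>i\<in>{1..n}. AE \<omega> in M. \<bar>X n i \<omega>\<bar> \<le> \<epsilon> n"
      using large
    proof eventually_elim
      case (elim n)
      have "AE \<omega> in M. \<bar>X n i \<omega>\<bar> \<le> \<epsilon> n" if "1 \<le> i" for i
        using T_bound[OF that conjunct1[OF elim]]
      proof eventually_elim
        case (elim \<omega>)
        have root: "1 \<le> sqrt (real (\<alpha> n))"
          using \<open>3 \<le> \<alpha> n \<and> 0 < n\<close> by simp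
        have "\<bar>?T (\<alpha> n) (Y i \<omega>) - m (\<alpha> n)\<bar> \<le> 3 * W / x\<^sup>2 * sqrt (real (\<alpha> n)) + \<bar>m (\<alpha> n)\<bar> * 1"
          using elim by linarith
        also have "\<dots> \<le> 3 * W / x\<^sup>2 * sqrt (real (\<alpha> n)) + \<bar>m (\<alpha> n)\<bar> * sqrt (real (\<alpha> n))"
          using root by (intro add_left_mono mult_left_mono) auto
        also have "\<dots> = sqrt (real (\<alpha> n)) * (3 * W / x\<^sup>2 + \<bar>m (\<alpha> n)\<bar>)"
          by (simp add: algebra_simps)
        finally have "c n / real n * \<bar>?T (\<alpha> n) (Y i \<omega>) - m (\<alpha> n)\<bar>
            \<le> c n / real n * (sqrt (real (\<alpha> n)) * (3 * W / x\<^sup>2 + \<bar>m (\<alpha> n)\<bar>))"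
          using scale(4)[OF \<open>3 \<le> \<alpha> n \<and> 0 < n\<close>] by (intro mult_left_mono) auto
        then show ?case
          using scale(4)[OF \<open>3 \<le> \<alpha> n \<and> 0 < n\<close>]
          unfolding X_def \<epsilon>_def scale(2)[OF \<open>3 \<le> \<alpha> n \<and> 0 < n\<close>, symmetric]
          by (simp add: abs_mult mult.assoc)
      qed
      then show ?case by auto
    qed
    have m_alpha: "(\<lambda>n. m (\<alpha> n)) \<longlonglongrightarrow> f x"
      by (rule filterlim_compose[OF m_lim rates(1)])
    have "\<epsilon> \<longlonglongrightarrow> 0 * (3 * W / x\<^sup>2 + \<bar>f x\<bar>)"
      unfolding \<epsilon>_def by (intro tendsto_intros rates(2) m_alpha)
    then show "\<epsilon> \<longlonglongrightarrow> 0" by simp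
    have "(\<lambda>n. V (\<alpha> n)) \<longlonglongrightarrow> \<sigma>2"
      by (rule filterlim_compose[OF V_lim rates(1)])
    moreover have "\<forall>\<^sub>F n in sequentially.
        V (\<alpha> n) = (\<Sum>i=1..n. expectation (\<lambda>\<omega>. (X n i \<omega>)\<^sup>2))"
      using large
    proof eventually_elim
      case (elim n)
      have "expectation (\<lambda>\<omega>. (X n i \<omega>)\<^sup>2) = (c n / real n)\<^sup>2 *
          (kernel_sq_factor W (\<alpha> n) x * m2 (\<alpha> n) - (m (\<alpha> n))\<^sup>2)" if "1 \<le> i" for i
      proof -
        have a2: "2 \<le> \<alpha> n" using elim by simp
        have "expectation (\<lambda>\<omega>. (?T (\<alpha> n) (Y i \<omega>) - m (\<alpha> n))\<^sup>2)
            = kernel_sq_factor W (\<alpha> n) x * m2 (\<alpha> n) - (m (\<alpha> n))\<^sup>2"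
          using variance_eq[OF T_int[OF that conjunct1[OF elim]]]
          unfolding mean[OF that a2] second[OF that a2] .
        then show ?thesis
          unfolding X_def power_mult_distrib by simp
      qed
      then have "(\<Sum>i=1..n. expectation (\<lambda>\<omega>. (X n i \<omega>)\<^sup>2)) = ((c n)\<^sup>2 / real n) *
          (kernel_sq_factor W (\<alpha> n) x * m2 (\<alpha> n) - (m (\<alpha> n))\<^sup>2)"
        by (simp add: power2_eq_square)
      then show ?case
        unfolding scale(1)[OF elim] by (simp add: V_def)
    qed
    ultimately show "(\<lambda>n. \<Sum>i=1..n. expectation (\<lambda>\<omega>. (X n i \<omega>)\<^sup>2)) \<longlonglongrightarrow> \<sigma>2"
      by (rule Lim_transform_eventually)
    show "b \<longlonglongrightarrow> 0"
    proof (rule Lim_null_comparison)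
      show "\<forall>\<^sub>F n in sequentially. norm (b n) \<le>
          B * x\<^sup>2 * (real n powr (1/2) / real (\<alpha> n) powr (5/4))"
        using large
      proof eventually_elim
        case (elim n)
        have "norm (b n) = c n * \<bar>m (\<alpha> n) - f x\<bar>"
          using scale(4)[OF elim] by (simp add: b_def abs_mult)
        also have "\<dots> \<le> c n * (B * (x\<^sup>2 / real (\<alpha> n)))"
          using scale(4)[OF elim] elim by (intro mult_left_mono bias) auto
        also have "\<dots> = B * x\<^sup>2 * (c n / real (\<alpha> n))"
          by simp
        finally show ?case unfolding scale(3)[OF elim] .
      qed
      show "(\<lambda>n. B * x\<^sup>2 * (real n powr (1/2) / real (\<alpha> n) powr (5/4))) \<longlonglongrightarrow> 0"
        by (rule tendsto_mult_right_zero[OF rates(3)])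
    qed
    show "0 < \<sigma>2"
      using W_pos x_pos fx_pos by (simp add: \<sigma>2_def)
  qed
  then show ?thesis
    unfolding eq[symmetric] \<sigma>2_def c_def .
qed

end
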